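(* Let $\widetilde G=(I,P;E)$ be a pinned $d$-isostatic graph. The following are equivalent: (1) $\widetilde G$ contains no proper pinned $d$-isostatic subgraph, i.e. there is no pinned $d$-isostatic subgraph $(I',P';E')$ with $\emptyset\ne I'\subsetneq I$; (2) for some (equivalently, any) $d$-directed orientation of $\widetilde G$, after contracting all pinned vertices to a single ground vertex, all inner vertices lie in a single strongly connected component (the graph is indecomposable); (3) for a generic configuration $p$, the pinned rigidity matrix $R(\widetilde G,p)$ has no proper lower block-triangular decomposition (i.e. none with more than one diagonal block).
   Context: Fix $d\ge1$. A pinned graph $\widetilde G=(I,P;E)$ has disjoint finite sets $I$ (inner vertices) and $P$ (pinned vertices) and a finite multiset $E$ of edges, each an unordered pair of distinct vertices with at least one endpoint in $I$. A subgraph is $(I',P';E')$ with $I'\subseteq I$, $P'\subseteq P$, $E'\subseteq E$ consisting of edges with endpoints in $I'\cup P'$ (and at least one endpoint in $I'$). A configuration $p$ assigns $p_v\in\mathbb R^d$ to each vertex. The pinned rigidity matrix $R(\widetilde G,p)$ is the $|E|\times d|I|$ matrix with one row per edge and $d$ columns per inner vertex: the row of $\{i,j\}$, $i,j\in I$, has $p_i-p_j$ in the columns of $i$, $p_j-p_i$ in the columns of $j$, zeros elsewhere; the row of $\{i,k\}$, $i\in I$, $k\in P$, has $p_i-p_k$ in the columns of $i$, zeros elsewhere. A configuration is generic if it lies in the open dense set where $R(\widetilde G,p)$ attains its maximum rank. A pinned graph is pinned $d$-isostatic if for some (equivalently every generic) $p$ its pinned rigidity matrix is square and invertible. A $d$-directed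 orientation orients each edge so every inner vertex has out-degree $d$ and every pinned vertex out-degree $0$. A lower block-triangular decomposition of $R(\widetilde G,p)$ is obtained by permuting rows and permuting inner vertices (keeping each vertex's $d$ columns together) so that the matrix is lower block-triangular with square diagonal blocks. A pinned $d$-isostatic graph satisfying these equivalent conditions is called $d$-Assur. *)

theory Defs
  imports
    "Graph_Theory.Digraph_Component"
    "Jordan_Normal_Form.DL_Rank"
begin

(* The edge multiset is represented by a set of edge labels together with the map ends sending
   a label to its unordered pair of endpoints; parallel edges are distinct labels with the same
   image. *)
record ('v, 'e) pinned_graph =
  inner :: "'v set"
  pinned :: "'v set"
  edges :: "'e set"
  ends :: "'e \<Rightarrow> 'v set"

definition wf_pinned_graph :: "('v, 'e) pinned_graph \<Rightarrow> bool" where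
  "wf_pinned_graph G \<longleftrightarrow>
     finite (inner G) \<and> finite (pinned G) \<and> inner G \<inter> pinned G = {} \<and> finite (edges G) \<and>
     (\<forall>e\<in>edges G. card (ends G e) = 2 \<and> ends G e \<subseteq> inner G \<union> pinned G \<and> ends G e \<inter> inner G \<noteq> {})"

(* Not necessarily induced: the edge set may omit edges of G between the chosen vertices. *)
definition pinned_subgraph :: "('v, 'e) pinned_graph \<Rightarrow> ('v, 'e) pinned_graph \<Rightarrow> bool" where
  "pinned_subgraph H G \<longleftrightarrow>
     inner H \<subseteq> inner G \<and> pinned H \<subseteq> pinned G \<and> edges H \<subseteq> edges G \<and> ends H = ends G \<and>
     wf_pinned_graph H"

definition configuration :: "nat \<Rightarrow> ('v, 'e) pinned_graph \<Rightarrow> ('v \<Rightarrow> real vec) \<Rightarrow> bool" where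
  "configuration d G p \<longleftrightarrow> (\<forall>v\<in>inner G \<union> pinned G. p v \<in> carrier_vec d)"

definition other_end :: "('v, 'e) pinned_graph \<Rightarrow> 'e \<Rightarrow> 'v \<Rightarrow> 'v" where
  "other_end G e i = (THE j. ends G e = {i, j})"

definition enumerates :: "'a list \<Rightarrow> 'a set \<Rightarrow> bool" where
  "enumerates xs A \<longleftrightarrow> distinct xs \<and> set xs = A"

(* The rigidity matrix with rows in the order es and inner vertices in the order vs;
   columns d * k, ..., d * k + d - 1 are the d columns of the inner vertex vs ! k. *)
definition ordered_rigidity_matrix ::
  "nat \<Rightarrow> ('v, 'e) pinned_graph \<Rightarrow> ('v \<Rightarrow> real vec) \<Rightarrow> 'e list \<Rightarrow> 'v list \<Rightarrow> real mat" where
  "ordered_rigidity_matrix d G p es vs =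
     mat (length es) (d * length vs)
       (\<lambda>(r, c). let e = es ! r; i = vs ! (c div d) in
          if i \<in> ends G e then (p i - p (other_end G e i)) $ (c mod d) else 0)"

(* The orders of rows and inner vertices are fixed arbitrarily, independently of p. *)
definition rigidity_matrix ::
  "nat \<Rightarrow> ('v, 'e) pinned_graph \<Rightarrow> ('v \<Rightarrow> real vec) \<Rightarrow> real mat" where
  "rigidity_matrix d G p =
     ordered_rigidity_matrix d G p
       (SOME es. enumerates es (edges G)) (SOME vs. enumerates vs (inner G))"

abbreviation mat_rank :: "real mat \<Rightarrow> nat" where
  "mat_rank A \<equiv> vec_space.rank (dim_row A) A"

definition generic :: "nat \<Rightarrow> ('v, 'e) pinned_graph \<Rightarrow> ('v \<Rightarrow> real vec) \<Rightarrow> bool" where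
  "generic d G p \<longleftrightarrow> configuration d G p \<and>
     (\<forall>q. configuration d G q \<longrightarrow>
        mat_rank (rigidity_matrix d G q) \<le> mat_rank (rigidity_matrix d G p))"

definition pinned_isostatic :: "nat \<Rightarrow> ('v, 'e) pinned_graph \<Rightarrow> bool" where
  "pinned_isostatic d G \<longleftrightarrow>
     wf_pinned_graph G \<and> (\<exists>p. configuration d G p \<and> invertible_mat (rigidity_matrix d G p))"

definition directed_orientation ::
  "nat \<Rightarrow> ('v, 'e) pinned_graph \<Rightarrow> ('v, 'e) pre_digraph \<Rightarrow> bool" where
  "directed_orientation d G D \<longleftrightarrow>
     verts D = inner G \<union> pinned G \<and> arcs D = edges G \<and>
     (\<forall>e\<in>edges G. ends G e = {tail D e, head D e}) \<and>
     (\<forall>v\<in>inner G. out_degree D v = d) \<and> (\<forall>v\<in>pinned G. out_degree D v = 0)"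

(* None is the ground vertex; it is present even if there are no pinned vertices. *)
definition contract_pinned ::
  "('v, 'e) pinned_graph \<Rightarrow> ('v, 'e) pre_digraph \<Rightarrow> ('v option, 'e) pre_digraph" where
  "contract_pinned G D =
     (let f = (\<lambda>v. if v \<in> pinned G then None else Some v) in
      \<lparr>verts = insert None (Some ` inner G), arcs = arcs D, tail = f \<circ> tail D, head = f \<circ> head D\<rparr>)"

definition indecomposable :: "('v, 'e) pinned_graph \<Rightarrow> ('v, 'e) pre_digraph \<Rightarrow> bool" where
  "indecomposable G D \<longleftrightarrow>
     (\<exists>S\<in>pre_digraph.sccs_verts (contract_pinned G D). Some ` inner G \<subseteq> S)"

definition block_range :: "nat list \<Rightarrow> nat \<Rightarrow> nat set" where
  "block_range bs k = {sum_list (take k bs) ..< sum_list (take (Suc k) bs)}"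

(* Square diagonal blocks of sizes bs ! 0, bs ! 1, ...; all blocks above the diagonal vanish. *)
definition lower_block_triangular :: "nat list \<Rightarrow> real mat \<Rightarrow> bool" where
  "lower_block_triangular bs A \<longleftrightarrow>
     dim_row A = sum_list bs \<and> dim_col A = sum_list bs \<and>
     (\<forall>k l. k < l \<and> l < length bs \<longrightarrow>
        (\<forall>r\<in>block_range bs k. \<forall>c\<in>block_range bs l. A $$ (r, c) = 0))"

(* Permuting rows and inner vertices amounts to choosing other orders es and vs. Since the d
   columns of an inner vertex stay together, each diagonal block consists of the columns of a
   nonempty set of inner vertices: ns lists the numbers of inner vertices in the blocks. *)
definition proper_block_decomposition ::
  "nat \<Rightarrow> ('v, 'e) pinned_graph \<Rightarrow> ('v \<Rightarrow> real vec) \<Rightarrow> bool" where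
  "proper_block_decomposition d G p \<longleftrightarrow>
     (\<exists>es vs ns. enumerates es (edges G) \<and> enumerates vs (inner G) \<and>
        length ns > 1 \<and> (\<forall>n\<in>set ns. n > 0) \<and>
        lower_block_triangular (map (\<lambda>n. d * n) ns) (ordered_rigidity_matrix d G p es vs))"

end

(* Isostaticity amounts to |E| = d |I| together with linear independence of the rows of the
   rigidity matrix for some p, a condition that does not depend on the orders of rows and columns
   and passes to subgraphs, because the rows of a subgraph vanish outside its own columns. Hence a
   subgraph is isostatic as soon as it has d edges per inner vertex. Such a subgraph is the same
   thing as a set X of inner vertices that no edge leaves towards I - X in a given d-directed
   orientation, and the same thing as the first diagonal block of a block-triangular form. *)

theory Submission
  imports Defs
begin

section \<open>Independence of the rows\<close>

lemma invertible_mat_iff_det: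
  fixes A :: "'a :: field mat"
  assumes A: "A \<in> carrier_mat n n"
  shows "invertible_mat A \<longleftrightarrow> det A \<noteq> 0"
proof
  assume "invertible_mat A"
  then obtain B where AB: "A * B = 1\<^sub>m n" and BA: "B * A = 1\<^sub>m (dim_row B)"
    using A unfolding invertible_mat_def inverts_mat_def by auto
  \<comment> \<open>Invertibility leaves the dimensions of \<open>B\<close> open; comparing the
    numbers of columns in the two identities fixes them.\<close>
  have "B \<in> carrier_mat n n"
    using arg_cong[OF AB, of dim_col] arg_cong[OF BA, of dim_col] A by auto
  from det_mult[OF A this, unfolded AB] show "det A \<noteq> 0" by auto
next
  assume "det A \<noteq> 0"
  from det_non_zero_imp_unit[OF A this, of "()"] obtain B
    where "B \<in> carrier_mat n n" "B * A = 1\<^sub>m n" "A * B = 1\<^sub>m n"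
    unfolding Units_def ring_mat_def by auto
  then show "invertible_mat A"
    using A unfolding invertible_mat_def inverts_mat_def by auto
qed

lemma enumerates_exists: "finite A \<Longrightarrow> \<exists>xs. enumerates xs A"
  unfolding enumerates_def using finite_distinct_list by blast

lemma enumerates_append:
  "\<lbrakk>enumerates xs A; enumerates ys B; A \<inter> B = {}\<rbrakk> \<Longrightarrow> enumerates (xs @ ys) (A \<union> B)"
  by (auto simp: enumerates_def)

lemma length_enumerates: "enumerates xs A \<Longrightarrow> length xs = card A"
  unfolding enumerates_def using distinct_card by fastforce

lemma nth_enumerates: "\<lbrakk>enumerates xs A; k < length xs\<rbrakk> \<Longrightarrow> xs ! k \<in> A"
  unfolding enumerates_def using nth_mem by blast

lemma enumerates_obtain:
  assumes "enumerates xs A" "x \<in> A"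
  obtains k where "k < length xs" "xs ! k = x"
  using assms unfolding enumerates_def by (metis in_set_conv_nth)

lemma enumerates_bij: "enumerates xs A \<Longrightarrow> bij_betw ((!) xs) {..<length xs} A"
  unfolding enumerates_def by (auto intro: bij_betw_nth)

section \<open>Row independence without chosen orders, and its relation to invertibility and
  rank\<close>

definition rigidity_coeff ::
  "('v, 'e) pinned_graph \<Rightarrow> ('v \<Rightarrow> real vec) \<Rightarrow> 'e \<Rightarrow> 'v \<Rightarrow> nat \<Rightarrow> real" where
  "rigidity_coeff G p e i a = (if i \<in> ends G e then (p i - p (other_end G e i)) $ a else 0)"

text \<open>A weight \<open>w\<close> as in the premise is a self-stress of the pinned framework:
  equilibrium is required at inner vertices only. Sums over edges instead of a matrix make the
  notion free of orders and comparable between a graph and its subgraphs.\<close>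

definition row_independent ::
  "nat \<Rightarrow> ('v, 'e) pinned_graph \<Rightarrow> ('v \<Rightarrow> real vec) \<Rightarrow> bool" where
  "row_independent d G p \<longleftrightarrow>
     (\<forall>w. (\<forall>i\<in>inner G. \<forall>a<d. (\<Sum>e\<in>edges G. w e * rigidity_coeff G p e i a) = 0) \<longrightarrow>
          (\<forall>e\<in>edges G. w e = 0))"

lemma ordered_rigidity_matrix_carrier [simp]:
  "ordered_rigidity_matrix d G p es vs \<in> carrier_mat (length es) (d * length vs)"
  "dim_row (ordered_rigidity_matrix d G p es vs) = length es"
  "dim_col (ordered_rigidity_matrix d G p es vs) = d * length vs"
  by (auto simp: ordered_rigidity_matrix_def)

lemma ordered_rigidity_matrix_entry:
  "\<lbrakk>r < length es; c < d * length vs\<rbrakk> \<Longrightarrow> ordered_rigidity_matrix d G p es vs $$ (r, c) =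
     rigidity_coeff G p (es ! r) (vs ! (c div d)) (c mod d)"
  by (auto simp: ordered_rigidity_matrix_def rigidity_coeff_def Let_def)

lemma column_index:
  fixes d :: nat
  assumes "k < n" "a < d"
  shows "d * k + a < d * n" "(d * k + a) div d = k" "(d * k + a) mod d = a"
proof -
  have "d * k + a < d * Suc k" using assms by simp
  also have "\<dots> \<le> d * n" using assms by (intro mult_le_mono2) simp
  finally show "d * k + a < d * n" .
  show "(d * k + a) div d = k" "(d * k + a) mod d = a"
    using assms(2) by (simp_all add: div_mult_self4 mod_mult_self4)
qed

text \<open>A square matrix is singular iff its transpose kills a nonzero vector. Read along
  \<open>es\<close>, such a vector is a nonzero weight on the edges whose weighted column sums all
  vanish.\<close>

lemma det_ordered_rigidity_matrix_iff:
  assumes es: "enumerates es (edges G)" and vs: "enumerates vs (inner G)"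
    and n: "length es = d * length vs"
  shows "det (ordered_rigidity_matrix d G p es vs) \<noteq> 0 \<longleftrightarrow> row_independent d G p"
proof -
  let ?M = "ordered_rigidity_matrix d G p es vs"
  let ?n = "length es"
  have M: "?M \<in> carrier_mat ?n ?n" by (intro carrier_matI) (simp_all add: n)
  have bij: "bij_betw ((!) es) {..<?n} (edges G)" by (rule enumerates_bij[OF es])
  have esE: "es ! r \<in> edges G" if "r < ?n" for r
    by (rule nth_enumerates[OF es that])
  have entry: "(transpose_mat ?M *\<^sub>v v) $ c =
      (\<Sum>e\<in>edges G. w e * rigidity_coeff G p e (vs ! (c div d)) (c mod d))"
    if v: "v \<in> carrier_vec ?n" and c: "c < ?n" and w: "\<And>r. r < ?n \<Longrightarrow> w (es ! r) = v $ r"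
    for v w c
  proof -
    have "(transpose_mat ?M *\<^sub>v v) $ c = (\<Sum>r<?n. ?M $$ (r, c) * v $ r)"
      using carrier_matD[OF M] v c
      by (simp add: scalar_prod_def lessThan_atLeast0 del: ordered_rigidity_matrix_carrier)
    also have "\<dots> = (\<Sum>r<?n. w (es ! r) * rigidity_coeff G p (es ! r) (vs ! (c div d)) (c mod d))"
      using c n by (intro sum.cong) (auto simp: ordered_rigidity_matrix_entry w)
    also have "\<dots> = (\<Sum>e\<in>edges G. w e * rigidity_coeff G p e (vs ! (c div d)) (c mod d))"
      by (rule sum.reindex_bij_betw[OF bij])
    finally show ?thesis .
  qed
  have zero: "(transpose_mat ?M *\<^sub>v v = 0\<^sub>v ?n) \<longleftrightarrow>
      (\<forall>i\<in>inner G. \<forall>a<d. (\<Sum>e\<in>edges G. w e * rigidity_coeff G p e i a) = 0)"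
    if v: "v \<in> carrier_vec ?n" and w: "\<And>r. r < ?n \<Longrightarrow> w (es ! r) = v $ r" for v w
  proof
    assume z: "transpose_mat ?M *\<^sub>v v = 0\<^sub>v ?n"
    show "\<forall>i\<in>inner G. \<forall>a<d. (\<Sum>e\<in>edges G. w e * rigidity_coeff G p e i a) = 0"
    proof (intro ballI allI impI)
      fix i a assume i: "i \<in> inner G" and a: "a < d"
      obtain k where k: "k < length vs" "vs ! k = i"
        using enumerates_obtain[OF vs i] by blast
      note ci = column_index[OF k(1) a]
      have "d * k + a < ?n" using ci(1) n by simp
      from entry[OF v this w] this show "(\<Sum>e\<in>edges G. w e * rigidity_coeff G p e i a) = 0"
        using ci k(2) z by simp
    qed
  next
    assume s: "\<forall>i\<in>inner G. \<forall>a<d. (\<Sum>e\<in>edges G. w e * rigidity_coeff G p e i a) = 0"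
    show "transpose_mat ?M *\<^sub>v v = 0\<^sub>v ?n"
    proof (rule eq_vecI)
      fix c assume "c < dim_vec (0\<^sub>v ?n :: real vec)"
      then have c: "c < ?n" by simp
      \<comment> \<open>A column exists only if \<open>d\<close> is positive; its number then
        decodes into a vertex and a coordinate below \<open>d\<close>.\<close>
      then have d: "d > 0" and k: "c div d < length vs" using n
        by (auto intro!: Nat.gr0I simp: less_mult_imp_div_less mult.commute)
      have "vs ! (c div d) \<in> inner G" by (rule nth_enumerates[OF vs k])
      then show "(transpose_mat ?M *\<^sub>v v) $ c = 0\<^sub>v ?n $ c"
        using entry[OF v c w] s d c by simp
    qed (use n in simp)
  qed
  have "det ?M = 0 \<longleftrightarrow> det (transpose_mat ?M) = 0" by (simp add: det_transpose[OF M])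
  also have "\<dots> \<longleftrightarrow> (\<exists>v. v \<in> carrier_vec ?n \<and> v \<noteq> 0\<^sub>v ?n \<and> transpose_mat ?M *\<^sub>v v = 0\<^sub>v ?n)"
    using M by (intro det_0_iff_vec_prod_zero_field) simp
  also have "\<dots> \<longleftrightarrow> \<not> row_independent d G p"
  proof
    assume "\<exists>v. v \<in> carrier_vec ?n \<and> v \<noteq> 0\<^sub>v ?n \<and> transpose_mat ?M *\<^sub>v v = 0\<^sub>v ?n"
    then obtain v where v: "v \<in> carrier_vec ?n" "v \<noteq> 0\<^sub>v ?n" "transpose_mat ?M *\<^sub>v v = 0\<^sub>v ?n"
      by blast
    \<comment> \<open>The vector is carried from row numbers over to edges along the bijection given
      by \<open>es\<close>.\<close>
    define w where "w e = v $ inv_into {..<?n} ((!) es) e" for e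
    have w: "w (es ! r) = v $ r" if "r < ?n" for r
      using that bij by (simp add: w_def bij_betw_def inv_into_f_f)
    obtain r where "r < ?n" "v $ r \<noteq> 0" using v(1,2) by (auto simp: vec_eq_iff)
    then have "es ! r \<in> edges G" "w (es ! r) \<noteq> 0" using w esE by auto
    then show "\<not> row_independent d G p"
      using zero[OF v(1) w] v(3) unfolding row_independent_def by blast
  next
    assume "\<not> row_independent d G p"
    then obtain w e where w: "e \<in> edges G" "w e \<noteq> 0"
      and s: "\<forall>i\<in>inner G. \<forall>a<d. (\<Sum>e\<in>edges G. w e * rigidity_coeff G p e i a) = 0"
      unfolding row_independent_def by blast
    obtain r where r: "r < ?n" "es ! r = e"
      using enumerates_obtain[OF es w(1)] by blast
    define v where "v = vec ?n (\<lambda>r. w (es ! r))"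
    have "v \<in> carrier_vec ?n" "\<And>r. r < ?n \<Longrightarrow> w (es ! r) = v $ r" by (auto simp: v_def)
    moreover from this have "transpose_mat ?M *\<^sub>v v = 0\<^sub>v ?n" using zero s by blast
    moreover have "v \<noteq> 0\<^sub>v ?n" using r w(2) by (auto simp: v_def vec_eq_iff)
    ultimately show "\<exists>v. v \<in> carrier_vec ?n \<and> v \<noteq> 0\<^sub>v ?n \<and> transpose_mat ?M *\<^sub>v v = 0\<^sub>v ?n"
      by blast
  qed
  finally show ?thesis by blast
qed

text \<open>The choices inside \<open>rigidity_matrix\<close> do not mention \<open>p\<close>, so
  one pair of orders serves all configurations.\<close>

lemma rigidity_matrix_ordered:
  assumes "wf_pinned_graph G"
  obtains es vs where "enumerates es (edges G)" "enumerates vs (inner G)"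
    "\<And>p. rigidity_matrix d G p = ordered_rigidity_matrix d G p es vs"
proof -
  have "finite (edges G)" "finite (inner G)" using assms by (auto simp: wf_pinned_graph_def)
  then show ?thesis
    by (intro that[OF _ _ rigidity_matrix_def] someI_ex[OF enumerates_exists])
qed

text \<open>Squareness is part of invertibility and yields the edge count; for a square matrix the
  determinant decides.\<close>

lemma invertible_rigidity_matrix_iff:
  assumes "wf_pinned_graph G"
  shows "invertible_mat (rigidity_matrix d G p) \<longleftrightarrow>
     card (edges G) = d * card (inner G) \<and> row_independent d G p"
proof -
  obtain es vs where es: "enumerates es (edges G)" and vs: "enumerates vs (inner G)"
    and R: "\<And>p. rigidity_matrix d G p = ordered_rigidity_matrix d G p es vs"
    using rigidity_matrix_ordered[OF assms, of d] by blast
  note len = length_enumerates[OF es] length_enumerates[OF vs]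
  show ?thesis
  proof (cases "length es = d * length vs")
    case True
    then have "rigidity_matrix d G p \<in> carrier_mat (length es) (length es)"
      by (simp add: R carrier_matI)
    then show ?thesis
      using invertible_mat_iff_det det_ordered_rigidity_matrix_iff[OF es vs True] True len R
      by metis
  next
    case False
    then show ?thesis using len by (auto simp: R invertible_mat_def)
  qed
qed

lemma pinned_isostatic_iff:
  "pinned_isostatic d G \<longleftrightarrow>
     wf_pinned_graph G \<and> card (edges G) = d * card (inner G) \<and>
     (\<exists>p. configuration d G p \<and> row_independent d G p)"
  unfolding pinned_isostatic_def using invertible_rigidity_matrix_iff by blast

lemma mat_rank_rigidity_matrix:
  assumes "wf_pinned_graph G" and "card (edges G) = d * card (inner G)"
  shows "mat_rank (rigidity_matrix d G p) \<le> card (edges G)"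
    and "mat_rank (rigidity_matrix d G p) = card (edges G) \<longleftrightarrow> row_independent d G p"
proof -
  obtain es vs where es: "enumerates es (edges G)" and vs: "enumerates vs (inner G)"
    and R: "\<And>p. rigidity_matrix d G p = ordered_rigidity_matrix d G p es vs"
    using rigidity_matrix_ordered[OF assms(1), of d] by blast
  note len = length_enumerates[OF es] length_enumerates[OF vs]
  have n: "length es = d * length vs" using len assms by simp
  have C: "rigidity_matrix d G p \<in> carrier_mat (card (edges G)) (card (edges G))"
    using n len by (auto simp: R intro!: carrier_matI)
  then have dim: "dim_row (rigidity_matrix d G p) = card (edges G)" by auto
  show "mat_rank (rigidity_matrix d G p) \<le> card (edges G)"
    unfolding dim by (rule vec_space.rank_le_nc[OF C])
  show "mat_rank (rigidity_matrix d G p) = card (edges G) \<longleftrightarrow> row_independent d G p"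
    unfolding dim using vec_space.det_rank_iff[OF C] det_ordered_rigidity_matrix_iff[OF es vs n] R
    by metis
qed

text \<open>Isostaticity provides a configuration of full rank, so the maximum rank is
  \<open>card (edges G)\<close>, and attaining it means having independent rows.\<close>

lemma generic_iff:
  assumes "pinned_isostatic d G"
  shows "generic d G p \<longleftrightarrow> configuration d G p \<and> row_independent d G p"
proof -
  have wf: "wf_pinned_graph G" and c: "card (edges G) = d * card (inner G)"
    using assms by (auto simp: pinned_isostatic_iff)
  obtain q where "configuration d G q" "row_independent d G q"
    using assms by (auto simp: pinned_isostatic_iff)
  then show ?thesis
    using mat_rank_rigidity_matrix[OF wf c] unfolding generic_def by (metis le_antisym)
qed

section \<open>Subgraphs and blocks\<close>

lemma rigidity_coeff_cong: "ends H = ends G \<Longrightarrow> rigidity_coeff H = rigidity_coeff G"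
  by (auto simp: rigidity_coeff_def other_end_def fun_eq_iff)

text \<open>Both ends of the edge are vertices of \<open>H\<close>, and those pinned in
  \<open>H\<close> are pinned in \<open>G\<close>, hence not inner there.\<close>

lemma pinned_subgraph_ends:
  assumes "wf_pinned_graph G" "pinned_subgraph H G" "e \<in> edges H"
  shows "ends G e \<inter> inner G \<subseteq> inner H"
proof -
  have "ends G e \<subseteq> inner H \<union> pinned H" "pinned H \<subseteq> pinned G" "inner G \<inter> pinned G = {}"
    using assms unfolding pinned_subgraph_def wf_pinned_graph_def by metis+
  then show ?thesis by blast
qed

text \<open>A self-stress of \<open>H\<close> extended by zero is a self-stress of \<open>G\<close>:
  the sums agree at inner vertices of \<open>H\<close>, and no edge of \<open>H\<close> meets any
  other inner vertex of \<open>G\<close>.\<close>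

lemma row_independent_subgraph:
  assumes wf: "wf_pinned_graph G" and H: "pinned_subgraph H G" and G: "row_independent d G p"
  shows "row_independent d H p"
  unfolding row_independent_def
proof (intro allI impI)
  fix w
  assume w: "\<forall>i\<in>inner H. \<forall>a<d. (\<Sum>e\<in>edges H. w e * rigidity_coeff H p e i a) = 0"
  define w' where "w' e = (if e \<in> edges H then w e else 0)" for e
  have sub: "edges H \<subseteq> edges G" "finite (edges G)" "ends H = ends G"
    using H wf by (auto simp: pinned_subgraph_def wf_pinned_graph_def)
  have "(\<Sum>e\<in>edges G. w' e * rigidity_coeff G p e i a) = 0" if i: "i \<in> inner G" and a: "a < d" for i a
  proof -
    have "(\<Sum>e\<in>edges G. w' e * rigidity_coeff G p e i a) =
        (\<Sum>e\<in>edges H. w e * rigidity_coeff H p e i a)"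
      unfolding rigidity_coeff_cong[OF sub(3)]
      by (rule sum.mono_neutral_cong_right) (use sub in \<open>auto simp: w'_def\<close>)
    also have "\<dots> = 0"
    proof (cases "i \<in> inner H")
      case False
      then have "i \<notin> ends H e" if "e \<in> edges H" for e
        using pinned_subgraph_ends[OF wf H that] i sub(3) by auto
      then show ?thesis by (simp add: rigidity_coeff_def)
    qed (use w a in blast)
    finally show ?thesis .
  qed
  then have "\<forall>e\<in>edges G. w' e = 0" using G unfolding row_independent_def by blast
  then show "\<forall>e\<in>edges H. w e = 0" using sub(1) unfolding w'_def by (metis subsetD)
qed

text \<open>Independence is inherited at the same configuration, so only the edge count has to be
  checked.\<close>

lemma pinned_isostatic_subgraph:
  assumes "pinned_isostatic d G" "pinned_subgraph H G" "card (edges H) = d * card (inner H)"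
  shows "pinned_isostatic d H"
proof -
  obtain p where p: "configuration d G p" "row_independent d G p" and wf: "wf_pinned_graph G"
    using assms(1) by (auto simp: pinned_isostatic_iff)
  have "configuration d H p" using p(1) assms(2)
    by (auto simp: configuration_def pinned_subgraph_def)
  moreover have "row_independent d H p" by (rule row_independent_subgraph[OF wf assms(2) p(2)])
  moreover have "wf_pinned_graph H" using assms(2) by (simp add: pinned_subgraph_def)
  ultimately show ?thesis using assms(3) by (auto simp: pinned_isostatic_iff)
qed

text \<open>This produces every subgraph constructed below. All pinned vertices are kept, so an edge
  stays inside as soon as its inner ends lie in \<open>X\<close>.\<close>

lemma pinned_subgraph_spanned:
  assumes "wf_pinned_graph G" "X \<subseteq> inner G" "F \<subseteq> edges G"
    and "\<And>e. e \<in> F \<Longrightarrow> ends G e \<inter> inner G \<subseteq> X"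
  shows "pinned_subgraph \<lparr>inner = X, pinned = pinned G, edges = F, ends = ends G\<rparr> G"
  unfolding pinned_subgraph_def wf_pinned_graph_def pinned_graph.simps
proof (intro conjI ballI)
  fix e assume e: "e \<in> F"
  then have "card (ends G e) = 2 \<and> ends G e \<subseteq> inner G \<union> pinned G \<and> ends G e \<inter> inner G \<noteq> {}"
    using assms(1,3) by (auto simp: wf_pinned_graph_def)
  then show "card (ends G e) = 2" "ends G e \<subseteq> X \<union> pinned G" "ends G e \<inter> X \<noteq> {}"
    using assms(4)[OF e] by auto
qed (use assms in \<open>auto simp: wf_pinned_graph_def intro: finite_subset\<close>)

text \<open>Two distinct ends make the definite description in \<open>other_end\<close>
  unique.\<close>

lemma ends_other_end:
  assumes "card (ends G e) = 2" "i \<in> ends G e"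
  shows "ends G e = {i, other_end G e i}" "other_end G e i \<noteq> i"
proof -
  obtain x y where "ends G e = {x, y}" "x \<noteq> y"
    using assms(1) by (auto simp: card_2_iff)
  then obtain j where j: "ends G e = {i, j}" "j \<noteq> i"
    using assms(2) by (cases "i = x") auto
  then have "other_end G e i = j"
    unfolding other_end_def by (intro the_equality) (auto simp: doubleton_eq_iff)
  then show "ends G e = {i, other_end G e i}" "other_end G e i \<noteq> i" using j by auto
qed

section \<open>Isostatic subgraphs and block-triangular forms\<close>

text \<open>Edges and inner vertices of \<open>H\<close> are listed first. Edges of \<open>H\<close>
  avoid the remaining inner vertices, so the upper right block vanishes whatever \<open>p\<close>
  is.\<close>

lemma proper_block_decomposition_if_subgraph:
  assumes wf: "wf_pinned_graph G" and c: "card (edges G) = d * card (inner G)"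
    and H: "pinned_subgraph H G" "card (edges H) = d * card (inner H)"
    and ne: "inner H \<noteq> {}" "inner H \<subset> inner G"
  shows "proper_block_decomposition d G p"
proof -
  have fin: "finite (edges G)" "finite (inner G)" and sub: "edges H \<subseteq> edges G" "inner H \<subseteq> inner G"
    using wf H(1) by (auto simp: wf_pinned_graph_def pinned_subgraph_def)
  then have finH: "finite (edges H)" "finite (inner H)" by (auto intro: finite_subset)
  obtain es1 es2 where es: "enumerates es1 (edges H)" "enumerates es2 (edges G - edges H)"
    using enumerates_exists fin finH by (meson finite_Diff)
  obtain vs1 vs2 where vs: "enumerates vs1 (inner H)" "enumerates vs2 (inner G - inner H)"
    using enumerates_exists fin finH by (meson finite_Diff)
  let ?es = "es1 @ es2" and ?vs = "vs1 @ vs2" and ?ns = "[length vs1, length vs2]"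
  have E: "enumerates ?es (edges G)" and V: "enumerates ?vs (inner G)"
    using enumerates_append[OF es] enumerates_append[OF vs] sub by (simp_all add: Un_absorb1)
  have l1: "length es1 = d * length vs1"
    using length_enumerates[OF es(1)] length_enumerates[OF vs(1)] H(2) by simp
  have "length ?es = d * length ?vs"
    using length_enumerates[OF E] length_enumerates[OF V] c by metis
  \<comment> \<open>Together with \<open>l1\<close> this makes the second diagonal block square as
    well.\<close>
  then have l: "length es1 + length es2 = d * length vs1 + d * length vs2"
    by (simp add: distrib_left)
  have pos: "length vs1 > 0" "length vs2 > 0"
    using vs ne unfolding enumerates_def by auto
  have zero: "ordered_rigidity_matrix d G p ?es ?vs $$ (r, k) = 0"
    if r: "r < d * length vs1" and k: "d * length vs1 \<le> k" "k < d * length vs1 + d * length vs2" for r k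
  proof -
    have d: "d > 0" using r by (auto intro: Nat.gr0I)
    have "r < length es1" using r l1 by simp
    then have e: "?es ! r \<in> edges H"
      using nth_enumerates[OF es(1)] by (simp add: nth_append)
    have q: "length vs1 \<le> k div d" using d k(1) by (simp add: less_eq_div_iff_mult_less_eq mult.commute)
    have "k < (length vs1 + length vs2) * d" using k(2) by (simp add: algebra_simps)
    then have "k div d < length vs1 + length vs2" by (rule less_mult_imp_div_less)
    then have "?vs ! (k div d) \<in> inner G - inner H"
      using q nth_enumerates[OF vs(2), of "k div d - length vs1"] by (simp add: nth_append)
    then have "?vs ! (k div d) \<notin> ends G (?es ! r)"
      using pinned_subgraph_ends[OF wf H(1) e] by auto
    then show ?thesis using r k l l1
      by (subst ordered_rigidity_matrix_entry) (auto simp: rigidity_coeff_def algebra_simps)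
  qed
  have "lower_block_triangular (map ((*) d) ?ns) (ordered_rigidity_matrix d G p ?es ?vs)"
    unfolding lower_block_triangular_def
  proof (intro conjI allI impI ballI)
    fix k l r c
    assume "k < l \<and> l < length (map ((*) d) ?ns)"
      and rc: "r \<in> block_range (map ((*) d) ?ns) k" "c \<in> block_range (map ((*) d) ?ns) l"
    then have "k = 0" "l = Suc 0" by auto
    then show "ordered_rigidity_matrix d G p ?es ?vs $$ (r, c) = 0"
      using rc by (intro zero) (auto simp: block_range_def)
  qed (use l in \<open>auto simp: algebra_simps\<close>)
  then show ?thesis
    unfolding proper_block_decomposition_def using E V pos
    by (intro exI[of _ ?es] exI[of _ ?vs] exI[of _ ?ns]) auto
qed

text \<open>After the first range, those of \<open>b # bs\<close> are the ranges of
  \<open>bs\<close> shifted by \<open>b\<close>.\<close>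

lemma in_block_range:
  "c < sum_list bs \<Longrightarrow> \<exists>l<length bs. c \<in> block_range bs l"
proof (induction bs arbitrary: c)
  case (Cons b bs)
  show ?case
  proof (cases "c < b")
    case True
    then have "c \<in> block_range (b # bs) 0" by (simp add: block_range_def)
    then show ?thesis by blast
  next
    case False
    then have "c - b < sum_list bs" using Cons.prems by simp
    then obtain l where "l < length bs" "c - b \<in> block_range bs l" using Cons.IH by blast
    then have "Suc l < length (b # bs)" "c \<in> block_range (b # bs) (Suc l)"
      using False by (auto simp: block_range_def)
    then show ?thesis by blast
  qed
qed simp

text \<open>If the row of \<open>e\<close> vanished, weight 1 on \<open>e\<close> and 0 elsewhere
  would be a nonzero self-stress.\<close>

lemma row_independent_nonzero:
  assumes "row_independent d G p" "finite (edges G)" "e \<in> edges G"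
  shows "\<exists>i\<in>inner G. \<exists>a<d. rigidity_coeff G p e i a \<noteq> 0"
proof (rule ccontr)
  assume z: "\<not> ?thesis"
  define w :: "'b \<Rightarrow> real" where "w e' = (if e' = e then 1 else 0)" for e'
  have "(\<Sum>e'\<in>edges G. w e' * rigidity_coeff G p e' i a) = 0" if "i \<in> inner G" "a < d" for i a
    using z that by (intro sum.neutral) (auto simp: w_def)
  then have "w e = 0" using assms(1,3) unfolding row_independent_def by blast
  then show False by (simp add: w_def)
qed

text \<open>A zero in the upper right block may also come from coinciding points \<open>p i = p j\<close>;
  but then the whole row of the edge vanishes, which independence of the rows excludes.\<close>

lemma not_in_ends_if_zero_coeffs:
  assumes wf: "wf_pinned_graph G" and conf: "configuration d G p" and ind: "row_independent d G p"
    and e: "e \<in> edges G" and i: "i \<in> inner G" and z: "\<And>a. a < d \<Longrightarrow> rigidity_coeff G p e i a = 0"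
  shows "i \<notin> ends G e"
proof
  assume ie: "i \<in> ends G e"
  have c2: "card (ends G e) = 2" and sub: "ends G e \<subseteq> inner G \<union> pinned G" and fin: "finite (edges G)"
    using wf e by (auto simp: wf_pinned_graph_def)
  define j where "j = other_end G e i"
  have ij: "ends G e = {i, j}" using ends_other_end[OF c2 ie] by (simp add: j_def)
  have "other_end G e j \<noteq> j" "ends G e = {j, other_end G e j}"
    using ends_other_end[OF c2, of j] ij by auto
  \<comment> \<open>This allows the coefficients of \<open>e\<close> to be evaluated at
    \<open>j\<close> too, where they are the negatives of those at \<open>i\<close>.\<close>
  then have ji: "other_end G e j = i" using ij by (metis insert_iff singletonD)
  have pd: "p i \<in> carrier_vec d" "p j \<in> carrier_vec d"
    using conf sub ij unfolding configuration_def by auto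
  have "rigidity_coeff G p e k a = 0" if a: "a < d" for k a
  proof -
    have "p i $ a = p j $ a"
      using z[OF a] a pd ie by (simp add: rigidity_coeff_def j_def[symmetric])
    then show ?thesis
      using a pd ij ji by (auto simp: rigidity_coeff_def j_def[symmetric])
  qed
  then show False using row_independent_nonzero[OF ind fin e] by blast
qed

text \<open>The first diagonal block spans the subgraph: the zeros to its right keep its edges away
  from all other inner vertices, and its squareness gives \<open>d\<close> edges per inner
  vertex.\<close>

lemma isostatic_subgraph_if_block_decomposition:
  assumes d: "d > 0" and iso: "pinned_isostatic d G" and conf: "configuration d G p"
    and ind: "row_independent d G p" and dec: "proper_block_decomposition d G p"
  shows "\<exists>H. pinned_subgraph H G \<and> pinned_isostatic d H \<and> inner H \<noteq> {} \<and> inner H \<subset> inner G"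
proof -
  have wf: "wf_pinned_graph G" using iso by (simp add: pinned_isostatic_iff)
  let ?M = "\<lambda>es vs. ordered_rigidity_matrix d G p es vs"
  obtain es vs ns where es: "enumerates es (edges G)" and vs: "enumerates vs (inner G)"
    and ns: "length ns > 1" "\<forall>n\<in>set ns. n > 0"
    and L: "lower_block_triangular (map ((*) d) ns) (?M es vs)"
    using dec unfolding proper_block_decomposition_def by blast
  obtain n m ms where nms: "ns = n # m # ms"
    using ns(1) by (metis One_nat_def length_0_conv length_Cons less_irrefl list.exhaust not_less_zero)
  have sum: "sum_list (map ((*) d) ns) = d * sum_list ns"
    by (induction ns) (auto simp: distrib_left)
  have len: "length es = d * sum_list ns" "length vs = sum_list ns"
    using L d unfolding lower_block_triangular_def sum by auto
  \<comment> \<open>A second block of positive size follows the first, so the subgraph will be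
    proper.\<close>
  have n: "0 < n" "n < length vs" using ns(2) len nms by auto
  define X F where "X = set (take n vs)" and "F = set (take (d * n) es)"
  have dn: "d * n \<le> length es" using n len by simp
  have cX: "card X = n" and cF: "card F = d * n"
    using es vs n dn unfolding X_def F_def enumerates_def
    by (simp_all add: distinct_card distinct_take)
  have FE: "F \<subseteq> edges G" and XI: "X \<subseteq> inner G"
    using es vs set_take_subset unfolding X_def F_def enumerates_def by metis+
  have ends: "ends G e \<inter> inner G \<subseteq> X" if e: "e \<in> F" for e
  proof
    fix i assume i: "i \<in> ends G e \<inter> inner G"
    obtain r where r: "r < d * n" "r < length es" "es ! r = e"
      using e dn unfolding F_def by (auto simp: in_set_conv_nth)
    obtain k where k: "k < length vs" "vs ! k = i"
      using enumerates_obtain[OF vs] i by blast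
    show "i \<in> X"
    proof (rule ccontr)
      assume "i \<notin> X"
      then have nk: "n \<le> k" using k unfolding X_def
        by (metis in_set_conv_nth length_take min_less_iff_conj not_le nth_take)
      have "rigidity_coeff G p e i a = 0" if a: "a < d" for a
      proof -
        note ci = column_index[OF k(1) a]
        obtain l where l: "l < length ns" "d * k + a \<in> block_range (map ((*) d) ns) l"
          using in_block_range[of "d * k + a" "map ((*) d) ns"] ci(1) sum len by auto
        \<comment> \<open>The column lies beyond the first block while row \<open>r\<close> lies in
          it, so the entry is above the diagonal.\<close>
        have "d * n \<le> d * k + a" by (rule trans_le_add1[OF mult_le_mono2[OF nk]])
        then have "l \<noteq> 0" using l(2) nms by (cases "l = 0") (auto simp: block_range_def)
        moreover have "r \<in> block_range (map ((*) d) ns) 0" using r nms by (simp add: block_range_def)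
        ultimately have "?M es vs $$ (r, d * k + a) = 0"
          using L l unfolding lower_block_triangular_def by simp
        then show ?thesis
          using ordered_rigidity_matrix_entry[OF r(2) ci(1), of G p] ci(2,3) r(3) k(2) by simp
      qed
      then have "i \<notin> ends G e" using not_in_ends_if_zero_coeffs[OF wf conf ind] FE e i by blast
      then show False using i by simp
    qed
  qed
  define H where "H = \<lparr>inner = X, pinned = pinned G, edges = F, ends = ends G\<rparr>"
  have sub: "pinned_subgraph H G" unfolding H_def
    by (rule pinned_subgraph_spanned[OF wf XI FE ends])
  have iH: "inner H = X" and eH: "edges H = F" by (simp_all add: H_def)
  have "pinned_isostatic d H"
    by (rule pinned_isostatic_subgraph[OF iso sub]) (simp add: cX cF iH eH)
  moreover have "X \<noteq> {}" using cX n by auto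
  moreover have "X \<noteq> inner G" using cX n length_enumerates[OF vs] by auto
  ultimately show ?thesis using sub XI iH by blast
qed

section \<open>Orientations\<close>

text \<open>A tail cannot be pinned: the edge would contribute to an out-degree that is zero, and by
  finiteness of the edge set degree zero means no outgoing arc.\<close>

lemma directed_orientationD:
  assumes "wf_pinned_graph G" "directed_orientation d G D" "e \<in> edges G"
  shows "ends G e = {tail D e, head D e}" "tail D e \<in> inner G" "head D e \<in> inner G \<union> pinned G"
proof -
  show E: "ends G e = {tail D e, head D e}" using assms unfolding directed_orientation_def by blast
  then have sub: "tail D e \<in> inner G \<union> pinned G" "head D e \<in> inner G \<union> pinned G"
    using assms(1,3) unfolding wf_pinned_graph_def by blast+
  then show "head D e \<in> inner G \<union> pinned G" by simp
  have "tail D e \<notin> pinned G"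
  proof
    assume "tail D e \<in> pinned G"
    then have "card (out_arcs D (tail D e)) = 0"
      using assms(2) unfolding directed_orientation_def out_degree_def by blast
    moreover have "finite (out_arcs D (tail D e))" "e \<in> out_arcs D (tail D e)"
      using assms unfolding directed_orientation_def wf_pinned_graph_def by (auto simp: out_arcs_def)
    ultimately show False by auto
  qed
  then show "tail D e \<in> inner G" using sub by blast
qed

text \<open>The edges split by their tails into disjoint sets of \<open>d\<close> arcs each. This
  count is what ties orientations to isostatic subgraphs.\<close>

lemma card_arcs_from:
  assumes "wf_pinned_graph G" "directed_orientation d G D" "X \<subseteq> inner G"
  shows "card {e \<in> edges G. tail D e \<in> X} = d * card X"
proof -
  have fin: "finite X" "finite (edges G)" and arcs: "arcs D = edges G"
    using assms unfolding wf_pinned_graph_def directed_orientation_def by (auto intro: finite_subset)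
  have "{e \<in> edges G. tail D e \<in> X} = (\<Union>x\<in>X. out_arcs D x)"
    using arcs by (auto simp: out_arcs_def)
  also have "card \<dots> = (\<Sum>x\<in>X. card (out_arcs D x))"
    using fin arcs by (intro card_UN_disjoint) (auto simp: out_arcs_def)
  also have "\<dots> = (\<Sum>x\<in>X. d)"
    using assms(2,3) unfolding directed_orientation_def out_degree_def by (intro sum.cong) auto
  finally show ?thesis by simp
qed

text \<open>A nonzero summand of the Leibniz formula matches the edges with the columns; every edge
  leaves the inner vertex owning the matched column.\<close>

lemma directed_orientation_exists:
  assumes d: "d > 0" and iso: "pinned_isostatic d G"
  shows "\<exists>D. directed_orientation d G D"
proof -
  have wf: "wf_pinned_graph G" and c: "card (edges G) = d * card (inner G)"
    using iso by (auto simp: pinned_isostatic_iff)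
  obtain p where ind: "row_independent d G p" using iso by (auto simp: pinned_isostatic_iff)
  obtain es vs where es: "enumerates es (edges G)" and vs: "enumerates vs (inner G)"
    using rigidity_matrix_ordered[OF wf] by blast
  let ?M = "ordered_rigidity_matrix d G p es vs" and ?n = "length es"
  have n: "?n = d * length vs" using length_enumerates[OF es] length_enumerates[OF vs] c by simp
  have M: "?M \<in> carrier_mat ?n ?n" by (intro carrier_matI) (simp_all add: n)
  have "\<exists>q. q permutes {0..<?n} \<and> (\<Prod>r = 0..<?n. ?M $$ (r, q r)) \<noteq> 0"
  proof (rule ccontr)
    assume "\<not> ?thesis"
    then have "det ?M = 0" unfolding det_def'[OF M] by (intro sum.neutral) auto
    then show False using det_ordered_rigidity_matrix_iff[OF es vs n] ind by blast
  qed
  then obtain q where q: "q permutes {0..<?n}" "(\<Prod>r = 0..<?n. ?M $$ (r, q r)) \<noteq> 0"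
    by blast
  then have nz: "?M $$ (r, q r) \<noteq> 0" if "r < ?n" for r
    using that by (simp add: prod_zero_iff)
  have qn: "q r < ?n" if "r < ?n" for r using permutes_in_image[OF q(1), of r] that by simp
  \<comment> \<open>\<open>inv_into\<close> recovers the row of \<open>e\<close>, and dividing the
    matched column by \<open>d\<close> gives the position of the vertex owning it.\<close>
  define t where "t e = vs ! (q (inv_into {..<?n} ((!) es) e) div d)" for e
  have bij: "bij_betw ((!) es) {..<?n} (edges G)" by (rule enumerates_bij[OF es])
  have t: "t (es ! r) = vs ! (q r div d)" if "r < ?n" for r
    using that bij by (simp add: t_def bij_betw_def inv_into_f_f)
  have qd: "q r div d < length vs" if "r < ?n" for r
    using qn[OF that] n by (simp add: less_mult_imp_div_less mult.commute)
  have tends: "t e \<in> ends G e" and tin: "t e \<in> inner G" if e: "e \<in> edges G" for e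
  proof -
    obtain r where r: "r < ?n" "es ! r = e" using enumerates_obtain[OF es e] by blast
    have "q r < d * length vs" using qn[OF r(1)] n by simp
    \<comment> \<open>A nonzero entry stands only in columns of an end of the edge, so the proposed
      tail is an end.\<close>
    from nz[OF r(1), unfolded ordered_rigidity_matrix_entry[OF r(1) this]]
    show "t e \<in> ends G e" using t[OF r(1)] r(2) by (auto simp: rigidity_coeff_def split: if_splits)
    show "t e \<in> inner G" using t[OF r(1)] r(2) nth_enumerates[OF vs qd[OF r(1)]] by simp
  qed
  define D where "D = \<lparr>verts = inner G \<union> pinned G, arcs = edges G, tail = t,
    head = (\<lambda>e. other_end G e (t e))\<rparr>"
  have "directed_orientation d G D"
    unfolding directed_orientation_def
  proof (intro conjI ballI)
    fix e assume e: "e \<in> edges G"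
    then have "card (ends G e) = 2" using wf by (auto simp: wf_pinned_graph_def)
    from ends_other_end(1)[OF this tends[OF e]] show "ends G e = {tail D e, head D e}"
      by (simp add: D_def)
  next
    fix v assume v: "v \<in> pinned G"
    then have "v \<notin> inner G" using wf by (auto simp: wf_pinned_graph_def)
    then have "out_arcs D v = {}" using tin by (auto simp: out_arcs_def D_def)
    then show "out_degree D v = 0" by (simp add: out_degree_def)
  next
    fix v assume "v \<in> inner G"
    then obtain k where k: "k < length vs" "vs ! k = v" using enumerates_obtain[OF vs] by blast
    define R where "R = {r. r < ?n \<and> q r div d = k}"
    have tk: "t (es ! r) = v \<longleftrightarrow> q r div d = k" if "r < ?n" for r
      using t[OF that] qd[OF that] k vs nth_eq_iff_index_eq unfolding enumerates_def by metis
    have "out_arcs D v = {e \<in> (!) es ` {..<?n}. t e = v}"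
      using bij by (simp add: out_arcs_def D_def bij_betw_def)
    also have "\<dots> = (!) es ` R" using tk by (auto simp: R_def)
    finally have "out_degree D v = card ((!) es ` R)" by (simp add: out_degree_def)
    also have "\<dots> = card R"
      using bij by (intro card_image) (auto simp: R_def bij_betw_def intro: inj_on_subset)
    also have "\<dots> = card (q ` R)"
      using permutes_inj[OF q(1)] by (intro card_image[symmetric]) (auto intro: inj_on_subset)
    \<comment> \<open>The permutation hits each of the \<open>d\<close> columns of \<open>v\<close>
      exactly once, which gives out-degree exactly \<open>d\<close>.\<close>
    also have "q ` R = (\<lambda>a. d * k + a) ` {..<d}"
    proof (intro equalityI subsetI)
      fix c assume "c \<in> q ` R"
      then have "c = d * k + c mod d" by (auto simp: R_def)
      then show "c \<in> (\<lambda>a. d * k + a) ` {..<d}" using d by (metis imageI lessThan_iff mod_less_divisor)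
    next
      fix c assume "c \<in> (\<lambda>a. d * k + a) ` {..<d}"
      then have c: "c < ?n" "c div d = k" using column_index[OF k(1)] n by auto
      then have "c \<in> q ` {0..<?n}" using permutes_image[OF q(1)] by simp
      then show "c \<in> q ` R" using c(2) by (auto simp: R_def)
    qed
    also have "card \<dots> = d" by (subst card_image) (auto simp: inj_on_def)
    finally show "out_degree D v = d" .
  qed (simp_all add: D_def)
  then show ?thesis by blast
qed

section \<open>Reachability in the contracted digraph\<close>

lemma contract_pinned_simps [simp]:
  "verts (contract_pinned G D) = insert None (Some ` inner G)"
  "arcs (contract_pinned G D) = arcs D"
  "tail (contract_pinned G D) e = (if tail D e \<in> pinned G then None else Some (tail D e))"
  "head (contract_pinned G D) e = (if head D e \<in> pinned G then None else Some (head D e))"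
  by (auto simp: contract_pinned_def Let_def)

lemma wf_digraph_contract_pinned:
  assumes "wf_pinned_graph G" "directed_orientation d G D"
  shows "wf_digraph (contract_pinned G D)"
proof
  fix e assume "e \<in> arcs (contract_pinned G D)"
  then have "e \<in> edges G" using assms(2) by (simp add: directed_orientation_def)
  note D = directed_orientationD[OF assms this]
  show "tail (contract_pinned G D) e \<in> verts (contract_pinned G D)"
    "head (contract_pinned G D) e \<in> verts (contract_pinned G D)"
    using D(2,3) by auto
qed

text \<open>Strong components are the classes of mutual reachability, so lying in a common one can
  be tested on pairs.\<close>

lemma indecomposable_iff:
  assumes "wf_pinned_graph G" "directed_orientation d G D"
  shows "indecomposable G D \<longleftrightarrow>
    (\<forall>u\<in>inner G. \<forall>v\<in>inner G. Some u \<rightarrow>\<^sup>*\<^bsub>contract_pinned G D\<^esub> Some v)"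
proof -
  interpret C: wf_digraph "contract_pinned G D" by (rule wf_digraph_contract_pinned[OF assms])
  show ?thesis
  proof
    assume "indecomposable G D"
    then obtain S where S: "S \<in> C.sccs_verts" "Some ` inner G \<subseteq> S"
      unfolding indecomposable_def by blast
    from S(1) have "\<forall>x\<in>S. \<forall>y\<in>S. x \<rightarrow>\<^sup>*\<^bsub>contract_pinned G D\<^esub> y"
      unfolding C.in_sccs_verts_conv_reachable by (elim conjE)
    then show "\<forall>u\<in>inner G. \<forall>v\<in>inner G. Some u \<rightarrow>\<^sup>*\<^bsub>contract_pinned G D\<^esub> Some v"
      using S(2) by (auto simp: image_subset_iff)
  next
    assume R: "\<forall>u\<in>inner G. \<forall>v\<in>inner G. Some u \<rightarrow>\<^sup>*\<^bsub>contract_pinned G D\<^esub> Some v"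
    have "\<exists>x\<in>verts (contract_pinned G D). Some ` inner G \<subseteq> C.scc_of x"
    \<comment> \<open>Without inner vertices the component of the ground vertex serves as
      witness.\<close>
    proof (cases "inner G = {}")
      case False
      then obtain u where "u \<in> inner G" by blast
      then show ?thesis using R by (intro bexI[of _ "Some u"]) (auto simp: C.scc_of_def)
    qed simp
    then show "indecomposable G D"
      unfolding indecomposable_def using C.scc_of_in_sccs_verts by blast
  qed
qed

text \<open>An isostatic subgraph has exactly \<open>d\<close> edges per inner vertex, so it contains all edges
  leaving its inner vertices, and no path leads out of it except to the ground.\<close>

lemma not_indecomposable_if_isostatic_subgraph:
  assumes wf: "wf_pinned_graph G" and D: "directed_orientation d G D"
    and H: "pinned_subgraph H G" "card (edges H) = d * card (inner H)"
    and ne: "inner H \<noteq> {}" "inner H \<subset> inner G"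
  shows "\<not> indecomposable G D"
proof
  assume "indecomposable G D"
  obtain u v where u: "u \<in> inner H" and v: "v \<in> inner G" "v \<notin> inner H" using ne by blast
  interpret C: wf_digraph "contract_pinned G D" by (rule wf_digraph_contract_pinned[OF wf D])
  have "Some u \<rightarrow>\<^sup>*\<^bsub>contract_pinned G D\<^esub> Some v"
    using \<open>indecomposable G D\<close> indecomposable_iff[OF wf D] u v ne by blast
  have fin: "finite (edges G)" and sub: "edges H \<subseteq> edges G" "inner H \<subseteq> inner G"
    using wf H(1) by (auto simp: wf_pinned_graph_def pinned_subgraph_def)
  have "edges H \<subseteq> {e \<in> edges G. tail D e \<in> inner H}"
    using directed_orientationD[OF wf D] pinned_subgraph_ends[OF wf H(1)] sub by blast
  \<comment> \<open>Both sets have \<open>d * card (inner H)\<close> elements, so the inclusion is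
    an equality.\<close>
  then have EH: "edges H = {e \<in> edges G. tail D e \<in> inner H}"
    using card_arcs_from[OF wf D sub(2)] H(2) fin by (intro card_subset_eq) auto
  have "y \<in> insert None (Some ` inner H)" if "Some u \<rightarrow>\<^sup>*\<^bsub>contract_pinned G D\<^esub> y" for y
    using that
  proof (induction rule: C.reachable_induct)
    case (step x y)
    then obtain e where e: "e \<in> edges G" and
      xy: "x = tail (contract_pinned G D) e" "y = head (contract_pinned G D) e"
      using D by (auto simp: arcs_ends_def arc_to_ends_def directed_orientation_def)
    note De = directed_orientationD[OF wf D e]
    \<comment> \<open>No arc starts at the ground, so a path that has reached it cannot come back to
      an inner vertex.\<close>
    have "tail D e \<notin> pinned G" using De(2) wf by (auto simp: wf_pinned_graph_def)
    then have "tail D e \<in> inner H" using step.IH xy(1) by auto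
    then have "e \<in> edges H" using EH e by simp
    then show ?case using pinned_subgraph_ends[OF wf H(1), of e] De xy(2) by auto
  qed (use u in simp)
  from this[OF \<open>Some u \<rightarrow>\<^sup>*\<^bsub>contract_pinned G D\<^esub> Some v\<close>] show False using v by auto
qed

text \<open>The inner vertices reachable from a suitable \<open>u\<close>, with all edges leaving
  them, form the subgraph: reachability keeps the inner heads inside, and counting by tails gives
  \<open>d\<close> edges per vertex. An unreachable \<open>v\<close> makes it proper.\<close>

lemma isostatic_subgraph_if_not_indecomposable:
  assumes iso: "pinned_isostatic d G" and D: "directed_orientation d G D"
    and nind: "\<not> indecomposable G D"
  shows "\<exists>H. pinned_subgraph H G \<and> pinned_isostatic d H \<and> inner H \<noteq> {} \<and> inner H \<subset> inner G"
proof -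
  have wf: "wf_pinned_graph G" using iso by (simp add: pinned_isostatic_iff)
  let ?C = "contract_pinned G D"
  interpret C: wf_digraph ?C by (rule wf_digraph_contract_pinned[OF wf D])
  obtain u v where u: "u \<in> inner G" and v: "v \<in> inner G" and uv: "\<not> Some u \<rightarrow>\<^sup>*\<^bsub>?C\<^esub> Some v"
    using nind indecomposable_iff[OF wf D] by blast
  define X where "X = {w \<in> inner G. Some u \<rightarrow>\<^sup>*\<^bsub>?C\<^esub> Some w}"
  define F where "F = {e \<in> edges G. tail D e \<in> X}"
  have XI: "X \<subseteq> inner G" and FE: "F \<subseteq> edges G" by (auto simp: X_def F_def)
  have ends: "ends G e \<inter> inner G \<subseteq> X" if e: "e \<in> F" for e
  proof -
    have eE: "e \<in> edges G" and tX: "tail D e \<in> X" using e by (auto simp: F_def)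
    note De = directed_orientationD[OF wf D eE]
    have disj: "inner G \<inter> pinned G = {}" using wf by (auto simp: wf_pinned_graph_def)
    have "head D e \<in> X" if h: "head D e \<in> inner G"
    proof -
      have "arc_to_ends ?C e = (Some (tail D e), Some (head D e))"
        using De(2) h disj by (auto simp: arc_to_ends_def)
      moreover have "e \<in> arcs ?C" using D eE by (simp add: directed_orientation_def)
      ultimately have "Some (tail D e) \<rightarrow>\<^bsub>?C\<^esub> Some (head D e)" by (rule C.dominatesI)
      then show ?thesis using tX h C.reachable_adj_trans by (auto simp: X_def)
    qed
    then show ?thesis using De(1) tX by auto
  qed
  define H where "H = \<lparr>inner = X, pinned = pinned G, edges = F, ends = ends G\<rparr>"
  have sub: "pinned_subgraph H G" unfolding H_def
    by (rule pinned_subgraph_spanned[OF wf XI FE ends])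
  have iH: "inner H = X" and eH: "edges H = F" by (simp_all add: H_def)
  have "card F = d * card X" unfolding F_def by (rule card_arcs_from[OF wf D XI])
  then have "pinned_isostatic d H"
    by (intro pinned_isostatic_subgraph[OF iso sub]) (simp add: iH eH)
  moreover have "u \<in> X" using u by (simp add: X_def)
  moreover have "v \<notin> X" using uv by (simp add: X_def)
  ultimately show ?thesis using sub XI iH v by blast
qed

theorem theorem3p4:
  fixes d :: nat and G :: "('v, 'e) pinned_graph"
  assumes "d \<ge> 1"
    and "pinned_isostatic d G"
  defines "cond1 \<equiv> \<not> (\<exists>H. pinned_subgraph H G \<and> pinned_isostatic d H \<and>
                          inner H \<noteq> {} \<and> inner H \<subset> inner G)"
    and "cond2_some \<equiv> (\<exists>D. directed_orientation d G D \<and> indecomposable G D)"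
    and "cond2_any \<equiv> (\<forall>D. directed_orientation d G D \<longrightarrow> indecomposable G D)"
    and "cond3_any \<equiv> (\<forall>p. generic d G p \<longrightarrow> \<not> proper_block_decomposition d G p)"
    and "cond3_some \<equiv> (\<exists>p. generic d G p \<and> \<not> proper_block_decomposition d G p)"
  shows "(cond1 \<longleftrightarrow> cond2_some) \<and> (cond2_some \<longleftrightarrow> cond2_any) \<and>
         (cond1 \<longleftrightarrow> cond3_any) \<and> (cond3_any \<longleftrightarrow> cond3_some)"
proof -
  have d: "d > 0" and wf: "wf_pinned_graph G" using assms(1,2) by (auto simp: pinned_isostatic_iff)
  have c: "card (edges G) = d * card (inner G)" using assms(2) by (simp add: pinned_isostatic_iff)
  obtain D where D: "directed_orientation d G D"
    using directed_orientation_exists[OF d assms(2)] by blast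
  obtain p where p: "generic d G p"
    using generic_iff[OF assms(2)] assms(2) unfolding pinned_isostatic_iff by blast
  \<comment> \<open>Two cycles of implications through \<open>cond1\<close> follow; \<open>D\<close>
    and \<open>p\<close> supply the passages from any to some.\<close>
  have "cond1 \<Longrightarrow> cond2_any"
    unfolding cond1_def cond2_any_def
    using isostatic_subgraph_if_not_indecomposable[OF assms(2)] by blast
  moreover have "cond2_any \<Longrightarrow> cond2_some"
    unfolding cond2_any_def cond2_some_def using D by blast
  moreover have "cond2_some \<Longrightarrow> cond1"
    unfolding cond1_def cond2_some_def pinned_isostatic_iff
    using not_indecomposable_if_isostatic_subgraph[OF wf] by blast
  moreover have "cond1 \<Longrightarrow> cond3_any"
    unfolding cond1_def cond3_any_def generic_iff[OF assms(2)]
    using isostatic_subgraph_if_block_decomposition[OF d assms(2)] by blast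
  moreover have "cond3_any \<Longrightarrow> cond3_some"
    unfolding cond3_any_def cond3_some_def using p by blast
  moreover have "cond3_some \<Longrightarrow> cond1"
    unfolding cond1_def cond3_some_def pinned_isostatic_iff
    using proper_block_decomposition_if_subgraph[OF wf c] by blast
  ultimately show ?thesis by blast
qed

end
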